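(* For every finite simple non-abelian group $G$, $\operatorname{cp}(G)<\frac{1}{5}$.
   Context: For a finite group $G$, the commuting probability of $G$ is $\operatorname{cp}(G)=\dfrac{|L(G)|}{|G|^2}$, where $L(G)=\{(x,y)\in G\times G: xy=yx\}$. *)

theory Defs
  imports Complex_Main "HOL-Algebra.Algebra"
begin

definition commuting_pairs :: "('a, 'b) monoid_scheme \<Rightarrow> ('a \<times> 'a) set" where
  "commuting_pairs G =
    {(x, y) \<in> carrier G \<times> carrier G. x \<otimes>\<^bsub>G\<^esub> y = y \<otimes>\<^bsub>G\<^esub> x}"

definition cp :: "('a, 'b) monoid_scheme \<Rightarrow> real" where
  "cp G = real (card (commuting_pairs G)) / (real (order G))\<^sup>2"

end

theory Submission
  imports Defs
begin

text \<open>
  Let \<open>G\<close> have order \<open>n\<close>.  The number of commuting pairs is \<open>\<Sum>x. \<bar>C(x)\<bar>\<close>, so a bound on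
  the commuting probability is a bound on the average size of a centralizer.  The centre of \<open>G\<close>
  is trivial, hence every \<open>C(x)\<close> with \<open>x \<noteq> \<one>\<close> is a proper subgroup, and a proper subgroup of
  index \<open>m\<close> makes \<open>G\<close> act faithfully on \<open>m\<close> cosets, whence \<open>n\<close> divides \<open>m!\<close>
  (\<open>order_dvd_fact_index\<close>).  Applied to subgroups of prime power order, which exist by Sylow's
  theorem, this excludes many small orders (\<open>excluded_orders\<close>).  It follows that proper subgroups
  have index at least 5 (\<open>index_ge_5\<close>): an index of at most 4 would make \<open>n\<close> a divisor of 24.

  If every nontrivial element has \<open>\<bar>C(x)\<bar> \<le> n / 6\<close>, the average is at most \<open>n / 6\<close> plus a
  contribution from \<open>x = \<one>\<close> that is small enough as soon as \<open>n > 25\<close>, which the excluded orders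
  give (\<open>commuting_pairs_bound_index_ge_6\<close>).

  Otherwise some centralizer \<open>H\<close> has index exactly 5.  The bound \<open>\<bar>C(x)\<bar> \<le> n / 5\<close> alone just misses
  the claim because of \<open>x = \<one>\<close>, so a sizable set of elements with much smaller centralizers is
  needed: the elements of order 5.  Write \<open>n = 5 c\<close> with \<open>c = \<bar>H\<bar>\<close> and let \<open>P\<close> be a subgroup of
  order 5.  As \<open>n\<close> divides 120, \<open>c\<close> divides 24 and \<open>P\<close> is a complement of \<open>H\<close>; in other words \<open>P\<close>
  is regular on the cosets of \<open>H\<close>.  Hence \<open>P\<close> is the centralizer of each of its nontrivial
  elements (\<open>centralizer_eq_prime_complement\<close>), and each of these has a class of \<open>c\<close> elements with
  centralizers of order 5.  One such class suffices if \<open>c \<ge> 10\<close>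
  (\<open>commuting_pairs_bound_index_5\<close>).  If \<open>c < 10\<close>, there is no room for a normalizer of \<open>P\<close>
  larger than \<open>P\<close>, since that normalizer has index at least 5 as well; but then the conjugates of
  the nontrivial elements of \<open>P\<close> fill everything outside \<open>H\<close> and \<open>H\<close> is normal, which is absurd
  (\<open>normalizer_neq_prime_complement\<close>).
\<close>

section \<open>The action on the cosets of a subgroup\<close>

lemma order_BijGroup:
  assumes "finite E"
  shows "order (BijGroup E) = fact (card E)"
proof -
  let ?r = "\<lambda>p. restrict p E"
  have "bij_betw ?r {p. p permutes E} (Bij E)"
  proof (rule bij_betwI')
    fix p q assume "p \<in> {p. p permutes E}" "q \<in> {p. p permutes E}"
    then have p: "p permutes E" and q: "q permutes E" by auto
    show "(?r p = ?r q) = (p = q)"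
    proof
      assume eq: "?r p = ?r q"
      show "p = q"
      proof
        fix x
        show "p x = q x"
        proof (cases "x \<in> E")
          case True
          then show ?thesis using fun_cong[OF eq, of x] by simp
        next
          case False
          then show ?thesis using p q by (simp add: permutes_not_in)
        qed
      qed
    qed simp
  next
    fix p assume "p \<in> {p. p permutes E}"
    then have "bij_betw p E E" by (simp add: permutes_imp_bij)
    then show "?r p \<in> Bij E" by (simp add: Bij_def)
  next
    fix f assume f: "f \<in> Bij E"
    define p where "p = (\<lambda>x. if x \<in> E then f x else x)"
    have "bij_betw p E E"
      using f by (simp add: Bij_def p_def cong: bij_betw_cong)
    then have "p permutes E"
      by (rule bij_imp_permutes) (simp add: p_def)
    moreover have "f = ?r p"
      using f by (auto simp: Bij_def p_def extensional_def restrict_def)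
    ultimately show "\<exists>p\<in>{p. p permutes E}. f = ?r p" by blast
  qed
  then have "card {p. p permutes E} = card (Bij E)"
    by (rule bij_betw_same_card)
  then show ?thesis
    by (simp add: order_def BijGroup_def card_permutations[OF refl assms])
qed

context group
begin

lemma coset_action:
  assumes "subgroup H G"
  shows "group_action G (rcosets H) (\<lambda>g. \<lambda>M\<in>rcosets H. M #> inv g)"
proof -
  interpret H: subgroup H G by fact
  have shift: "(H #> a) #> b = H #> (a \<otimes> b)" if "a \<in> carrier G" "b \<in> carrier G" for a b
    using that H.subset by (simp add: coset_mult_assoc)
  have closed: "M #> g \<in> rcosets H" if "M \<in> rcosets H" "g \<in> carrier G" for M g
    using that shift unfolding RCOSETS_def by auto
  have sub: "M \<subseteq> carrier G" if "M \<in> rcosets H" for M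
    using that H.rcosets_carrier is_group by blast
  have bij: "(\<lambda>M\<in>rcosets H. M #> inv g) \<in> Bij (rcosets H)" if g: "g \<in> carrier G" for g
  proof -
    have "bij_betw (\<lambda>M. M #> inv g) (rcosets H) (rcosets H)"
      by (rule bij_betw_byWitness[where f' = "\<lambda>M. M #> g"])
         (use g closed sub in \<open>auto simp: coset_mult_assoc\<close>)
    then show ?thesis by (simp add: Bij_def)
  qed
  have "(\<lambda>g. \<lambda>M\<in>rcosets H. M #> inv g) \<in> hom G (BijGroup (rcosets H))"
  proof (rule homI)
    fix g assume "g \<in> carrier G"
    then show "(\<lambda>M\<in>rcosets H. M #> inv g) \<in> carrier (BijGroup (rcosets H))"
      using bij by (simp add: BijGroup_def)
  next
    fix g h assume "g \<in> carrier G" "h \<in> carrier G"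
    then show "(\<lambda>M\<in>rcosets H. M #> inv (g \<otimes> h)) =
        (\<lambda>M\<in>rcosets H. M #> inv g) \<otimes>\<^bsub>BijGroup (rcosets H)\<^esub> (\<lambda>M\<in>rcosets H. M #> inv h)"
      using bij closed sub
      by (auto simp: BijGroup_def compose_def inv_mult_group coset_mult_assoc intro!: restrict_ext)
  qed
  then show ?thesis
    unfolding group_action_def group_hom_def group_hom_axioms_def
    by (simp add: is_group group_BijGroup)
qed

end

text \<open>
  The kernel of the action on the \<open>m\<close> cosets lies in \<open>H\<close>, so it is a proper normal subgroup and
  simplicity makes it trivial: \<open>G\<close> embeds in the symmetric group on \<open>m\<close> points.
\<close>

lemma (in simple_group) order_dvd_fact_index:
  assumes fin: "finite (carrier G)" and H: "subgroup H G"
    and index: "m * card H = order G" and "m \<noteq> 1"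
  shows "order G dvd fact m"
proof -
  define \<phi> where "\<phi> = (\<lambda>g. \<lambda>M\<in>rcosets H. M #> inv g)"
  interpret H: subgroup H G by fact
  interpret act: group_action G "rcosets H" \<phi>
    unfolding \<phi>_def by (rule coset_action[OF H])
  interpret hom: group_hom G "BijGroup (rcosets H)" \<phi>
    by (rule act.group_hom)
  have "card H > 0"
    using H fin by (metis card_gt_0_iff H.one_closed H.subset empty_iff finite_subset)
  with lagrange[OF H] index have m: "card (rcosets H) = m" 
    by (metis mult_cancel_right not_less0)
  have fin_cosets: "finite (rcosets H)"
    using fin by (simp add: RCOSETS_def)
  have "kernel G (BijGroup (rcosets H)) \<phi> \<noteq> carrier G"
  proof
    assume trivial: "kernel G (BijGroup (rcosets H)) \<phi> = carrier G"
    have "g \<in> H" if g: "g \<in> carrier G" for g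
    proof -
      have "inv g \<in> kernel G (BijGroup (rcosets H)) \<phi>" using g trivial by simp
      then have "\<phi> (inv g) = (\<lambda>M\<in>rcosets H. M)" by (simp add: kernel_def BijGroup_def)
      moreover have "H \<in> rcosets H" using H by (simp add: H.subgroup_in_rcosets is_group)
      ultimately have "H #> g = H" using g unfolding \<phi>_def
        by (metis (no_types, lifting) inv_inv restrict_apply')
      then show "g \<in> H" using rcos_self[OF g H] by simp
    qed
    then have "H = carrier G" using H.subset by blast
    then show False using index \<open>m \<noteq> 1\<close> order_gt_one by (simp add: order_def)
  qed
  then have "kernel G (BijGroup (rcosets H)) \<phi> = {\<one>}"
    using no_real_normal_subgroup[OF hom.normal_kernel] by blast
  then have "inj_on \<phi> (carrier G)" by (rule hom.trivial_ker_imp_inj)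
  then have "card (\<phi> ` carrier G) = order G" by (simp add: card_image order_def)
  moreover have "subgroup (\<phi> ` carrier G) (BijGroup (rcosets H))"
    by (rule hom.img_is_subgroup)
  ultimately have "order G dvd order (BijGroup (rcosets H))"
    by (metis group.lagrange[OF group_BijGroup] dvd_triv_right)
  then show ?thesis by (simp add: order_BijGroup fin_cosets m)
qed

section \<open>Centralizers and conjugacy classes\<close>

definition centralizer :: "('a, 'b) monoid_scheme \<Rightarrow> 'a \<Rightarrow> 'a set" where
  "centralizer G x = {g \<in> carrier G. g \<otimes>\<^bsub>G\<^esub> x = x \<otimes>\<^bsub>G\<^esub> g}"

definition conjugacy_class :: "('a, 'b) monoid_scheme \<Rightarrow> 'a \<Rightarrow> 'a set" where
  "conjugacy_class G x = (\<lambda>g. g \<otimes>\<^bsub>G\<^esub> x \<otimes>\<^bsub>G\<^esub> inv\<^bsub>G\<^esub> g) ` carrier G"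

lemma card_commuting_pairs:
  assumes "finite (carrier G)"
  shows "card (commuting_pairs G) = (\<Sum>x\<in>carrier G. card (centralizer G x))"
proof -
  have "commuting_pairs G = (SIGMA x:carrier G. centralizer G x)"
    by (auto simp: commuting_pairs_def centralizer_def)
  then show ?thesis
    using assms by (simp add: card_SigmaI centralizer_def)
qed

context group
begin

lemma commute_iff_conj_fixes:
  assumes "g \<in> carrier G" "x \<in> carrier G"
  shows "g \<otimes> x = x \<otimes> g \<longleftrightarrow> g \<otimes> x \<otimes> inv g = x"
  using assms inv_solve_right'[of x "g \<otimes> x" g] by auto

lemma centralizer_eq_stabilizer:
  assumes "x \<in> carrier G"
  shows "centralizer G x = stabilizer G (\<lambda>g. \<lambda>h\<in>carrier G. g \<otimes> h \<otimes> inv g) x"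
  using assms by (auto simp: centralizer_def stabilizer_def commute_iff_conj_fixes)

lemma subgroup_centralizer: "x \<in> carrier G \<Longrightarrow> subgroup (centralizer G x) G"
  using group_action.stabilizer_subgroup[OF action_by_conjugation]
  by (simp add: centralizer_eq_stabilizer)

lemma card_class_times_card_centralizer:
  assumes "x \<in> carrier G"
  shows "card (conjugacy_class G x) * card (centralizer G x) = order G"
proof -
  have "conjugacy_class G x = orbit G (\<lambda>g. \<lambda>h\<in>carrier G. g \<otimes> h \<otimes> inv g) x"
    using assms by (auto simp: conjugacy_class_def orbit_def)
  then show ?thesis
    using group_action.orbit_stabilizer_theorem[OF action_by_conjugation assms]
    by (simp add: centralizer_eq_stabilizer assms)
qed

lemma card_subgroup_dvd:
  assumes "subgroup H G" "subgroup K G" "H \<subseteq> K"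
  shows "card H dvd card K"
proof -
  interpret K: group "G\<lparr>carrier := K\<rparr>" using assms by (simp add: subgroup_imp_group)
  have "subgroup H (G\<lparr>carrier := K\<rparr>)" using assms by (simp add: subgroup_incl)
  from K.lagrange[OF this] show ?thesis
    by (auto simp: order_def intro: dvdI[where k = "card _"] dest: sym)
qed

lemma card_one_subgroup: "subgroup H G \<Longrightarrow> card H = 1 \<Longrightarrow> H = {\<one>}"
  by (metis card_1_singletonE singletonD subgroup.one_closed)

text \<open>A group of prime order is generated by each of its nontrivial elements.\<close>

lemma prime_subgroup_subset:
  assumes P: "subgroup P G" "Factorial_Ring.prime (card P)" and K: "subgroup K G"
    and x: "x \<in> P" "x \<in> K" "x \<noteq> \<one>"
  shows "P \<subseteq> K"
proof -
  have PK: "subgroup (P \<inter> K) G" by (rule subgroups_Inter_pair[OF P(1) K])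
  have "card (P \<inter> K) dvd card P" by (rule card_subgroup_dvd[OF PK P(1)]) simp
  moreover have "card (P \<inter> K) \<noteq> 1" using card_one_subgroup[OF PK] x by blast
  ultimately have "card (P \<inter> K) = card P" using P(2) by (auto simp: prime_nat_iff)
  moreover have "finite P" using P(2) by (intro card_ge_0_finite prime_gt_0_nat)
  ultimately have "P \<inter> K = P" by (simp add: card_subset_eq)
  then show ?thesis by blast
qed

section \<open>Complements, conjugates and cores of subgroups\<close>

lemma card_set_mult_trivial_Int:
  assumes H: "subgroup H G" and K: "subgroup K G" and triv: "H \<inter> K = {\<one>}"
  shows "card (H <#> K) = card H * card K"
proof -
  interpret H: subgroup H G by fact
  interpret K: subgroup K G by fact
  have "inj_on (\<lambda>(h, k). h \<otimes> k) (H \<times> K)"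
  proof (rule inj_onI, clarify)
    fix h k h' k' assume in_sub: "h \<in> H" "k \<in> K" "h' \<in> H" "k' \<in> K" and eq: "h \<otimes> k = h' \<otimes> k'"
    then have G: "h \<in> carrier G" "k \<in> carrier G" "h' \<in> carrier G" "k' \<in> carrier G" by auto
    have "inv h' \<otimes> h = k' \<otimes> inv k"
    proof -
      have "inv h' \<otimes> h = inv h' \<otimes> (h \<otimes> k) \<otimes> inv k" using G by (simp add: m_assoc)
      also have "\<dots> = k' \<otimes> inv k" unfolding eq using G by (simp flip: m_assoc)
      finally show ?thesis .
    qed
    moreover have "inv h' \<otimes> h \<in> H" "k' \<otimes> inv k \<in> K" using in_sub by auto
    ultimately have "inv h' \<otimes> h = \<one>" "k' \<otimes> inv k = \<one>" using triv by auto
    then show "h = h' \<and> k = k'"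
      using G inv_solve_left'[of "\<one>" h' h] inv_solve_right'[of "\<one>" k' k] by simp
  qed
  moreover have "H <#> K = (\<lambda>(h, k). h \<otimes> k) ` (H \<times> K)"
    by (auto simp: set_mult_def)
  ultimately show ?thesis by (simp add: card_image card_cartesian_product)
qed

text \<open>
  Conjugates are written as images under \<open>\<lambda>h. g \<otimes> h \<otimes> inv g\<close>, so that their elements are visibly
  conjugates of elements of the subgroup; this lemma connects them with the coset form in which the
  normalizer is defined.
\<close>

lemma conj_image_eq_cosets:
  assumes "H \<subseteq> carrier G" "g \<in> carrier G"
  shows "(\<lambda>h. g \<otimes> h \<otimes> inv g) ` H = g <# H #> inv g"
  by (auto simp: l_coset_def r_coset_def)

lemma subgroup_conj_image:
  assumes "subgroup H G" "g \<in> carrier G"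
  shows "subgroup ((\<lambda>h. g \<otimes> h \<otimes> inv g) ` H) G"
  using subgroup_conjugation_is_surj2[OF assms(2,1)]
  by (simp add: conj_image_eq_cosets subgroup.subset assms)

lemma card_conj_image:
  assumes "H \<subseteq> carrier G" "g \<in> carrier G"
  shows "card ((\<lambda>h. g \<otimes> h \<otimes> inv g) ` H) = card H"
  using assms by (intro card_image inj_onI) (blast intro: conjugation_is_inj)

lemma mem_normalizer_iff:
  assumes "H \<subseteq> carrier G"
  shows "g \<in> normalizer G H \<longleftrightarrow> g \<in> carrier G \<and> (\<lambda>h. g \<otimes> h \<otimes> inv g) ` H = H"
  using assms by (simp add: normalizer_def stabilizer_def conj_image_eq_cosets cong: conj_cong)

lemma conj_conj:
  assumes "g \<in> carrier G" "h \<in> carrier G" "x \<in> carrier G"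
  shows "g \<otimes> (h \<otimes> x \<otimes> inv h) \<otimes> inv g = (g \<otimes> h) \<otimes> x \<otimes> inv (g \<otimes> h)"
  using assms by (simp add: inv_mult_group m_assoc)

lemma conjugacy_class_closed:
  assumes "g \<in> carrier G" "x \<in> carrier G" "y \<in> conjugacy_class G x"
  shows "g \<otimes> y \<otimes> inv g \<in> conjugacy_class G x"
  using assms unfolding conjugacy_class_def by (auto simp: conj_conj)

lemma normal_core:
  assumes H: "subgroup H G"
  shows "{g \<in> carrier G. \<forall>a\<in>carrier G. inv a \<otimes> g \<otimes> a \<in> H} \<lhd> G" (is "?C \<lhd> G")
proof -
  interpret H: subgroup H G by fact
  have split: "inv a \<otimes> (g \<otimes> h) \<otimes> a = (inv a \<otimes> g \<otimes> a) \<otimes> (inv a \<otimes> h \<otimes> a)"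
    if "a \<in> carrier G" "g \<in> carrier G" "h \<in> carrier G" for a g h
  proof -
    have "a \<otimes> (inv a \<otimes> (h \<otimes> a)) = h \<otimes> a" using that by (simp flip: m_assoc)
    then show ?thesis using that by (simp add: m_assoc)
  qed
  have inverse: "inv a \<otimes> inv g \<otimes> a = inv (inv a \<otimes> g \<otimes> a)"
    if "a \<in> carrier G" "g \<in> carrier G" for a g
    using that by (simp add: inv_mult_group m_assoc)
  have "subgroup ?C G"
    by (rule subgroupI) (auto simp: split inverse intro!: exI[of _ "\<one>"])
  moreover have "x \<otimes> g \<otimes> inv x \<in> ?C" if x: "x \<in> carrier G" and g: "g \<in> ?C" for x g
  proof -
    have "inv a \<otimes> (x \<otimes> g \<otimes> inv x) \<otimes> a \<in> H" if a: "a \<in> carrier G" for a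
    proof -
      have "inv (inv x \<otimes> a) \<otimes> g \<otimes> (inv x \<otimes> a) \<in> H" using x a g by blast
      moreover have "inv (inv x \<otimes> a) \<otimes> g \<otimes> (inv x \<otimes> a) = inv a \<otimes> (x \<otimes> g \<otimes> inv x) \<otimes> a"
        using x a g by (simp add: inv_mult_group m_assoc)
      ultimately show ?thesis by simp
    qed
    then show ?thesis using x g by blast
  qed
  ultimately show ?thesis by (simp add: normal_inv_iff)
qed

end

section \<open>Excluding small orders and small indices\<close>

locale finite_nonabelian_simple_group = simple_group +
  assumes fin: "finite (carrier G)" and nonabelian: "\<not> comm_group G"
begin

text \<open>
  An element with full centralizer would be central; the centre is normal, so it would be all of
  \<open>G\<close>.
\<close>

lemma centralizer_proper:
  assumes x: "x \<in> carrier G" "x \<noteq> \<one>"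
  shows "centralizer G x \<noteq> carrier G"
proof
  define Z where "Z = (\<Inter>y\<in>carrier G. centralizer G y)"
  have Z_eq: "Z = {z \<in> carrier G. \<forall>g\<in>carrier G. g \<otimes> z = z \<otimes> g}"
    unfolding Z_def centralizer_def by fastforce
  assume "centralizer G x = carrier G"
  then have "x \<in> Z" using x unfolding Z_eq centralizer_def by blast
  have "subgroup Z G"
    unfolding Z_def by (rule subgroups_Inter) (auto simp: subgroup_centralizer)
  moreover have "g \<otimes> z \<otimes> inv g \<in> Z" if "g \<in> carrier G" "z \<in> Z" for g z
  proof -
    have "g \<otimes> z \<otimes> inv g = z"
      using that commute_iff_conj_fixes[of g z] by (auto simp: Z_eq)
    then show ?thesis using that by simp
  qed
  ultimately have "Z \<lhd> G" by (simp add: normal_inv_iff)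
  then have "Z = carrier G" using no_real_normal_subgroup \<open>x \<in> Z\<close> x(2) by blast
  then have "comm_group G"
    by (intro group_comm_groupI) (auto simp: Z_eq)
  then show False using nonabelian by blast
qed

lemma centralizer_index:
  assumes x: "x \<in> carrier G" "x \<noteq> \<one>"
  shows "card (conjugacy_class G x) \<noteq> 1" "2 \<le> card (centralizer G x)"
proof -
  have "{\<one>, x} \<subseteq> centralizer G x" using x by (auto simp: centralizer_def)
  moreover have "finite (centralizer G x)" using fin by (simp add: centralizer_def)
  ultimately have "card {\<one>, x} \<le> card (centralizer G x)" by (rule card_mono[rotated])
  then show "2 \<le> card (centralizer G x)" using x(2) by simp
  have "centralizer G x \<subseteq> carrier G" by (auto simp: centralizer_def)
  then have "card (centralizer G x) \<noteq> order G"
    using centralizer_proper[OF x] fin by (metis card_subset_eq order_def)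
  then show "card (conjugacy_class G x) \<noteq> 1"
    using card_class_times_card_centralizer[OF x(1)] by auto
qed

lemma exists_nontrivial: obtains x where "x \<in> carrier G" "x \<noteq> \<one>"
  using simple_not_triv by blast

lemma order_ge_4: "4 \<le> order G"
proof -
  obtain x where x: "x \<in> carrier G" "x \<noteq> \<one>" by (rule exists_nontrivial)
  have "card (conjugacy_class G x) \<noteq> 0"
    using card_class_times_card_centralizer[OF x(1)] order_gt_one by (metis mult_0 not_one_less_zero)
  then have "2 \<le> card (conjugacy_class G x)" using centralizer_index(1)[OF x] by linarith
  from mult_le_mono[OF this centralizer_index(2)[OF x]] show ?thesis
    by (simp add: card_class_times_card_centralizer[OF x(1)])
qed

text \<open>
  Sylow's theorem provides a subgroup for every prime power that divides the order.  Powers below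
  the maximal one are what excludes the orders 4, 8 and 16, which are themselves prime powers.
\<close>

lemma order_dvd_fact_cofactor:
  assumes "Factorial_Ring.prime p" "order G = p ^ a * m" "m \<noteq> 1"
  shows "order G dvd fact m"
proof -
  obtain H where "subgroup H G" "card H = p ^ a"
    using sylow_thm[OF assms(1) is_group assms(2) fin] by blast
  with order_dvd_fact_index[OF fin] assms show ?thesis by (metis mult.commute)
qed

text \<open>
  Each of these numbers is a product \<open>p ^ a * m\<close> that does not divide \<open>m!\<close>.  The list contains the
  orders that have to be ruled out for \<open>index_ge_5\<close> and \<open>order_gt_25\<close>.
\<close>

lemma excluded_orders:
  "order G \<notin> {4, 6, 8, 12, 14, 16, 18, 20, 21, 22, 24}"
proof -
  have primes: "Factorial_Ring.prime (2::nat)" "Factorial_Ring.prime (3::nat)" "Factorial_Ring.prime (5::nat)"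
    "Factorial_Ring.prime (7::nat)" "Factorial_Ring.prime (11::nat)"
    by simp_all
  note ord = order_dvd_fact_cofactor
  \<comment> \<open>The arguments are the exponent and the cofactor; in order, the factorizations are those of
     4, 6, 8, 12, 14, 16, 18, 20, 21, 22 and 24.\<close>
  show ?thesis
    using ord[OF primes(1), of 1 2] ord[OF primes(2), of 1 2] ord[OF primes(1), of 2 2]
      ord[OF primes(1), of 2 3] ord[OF primes(4), of 1 2] ord[OF primes(1), of 3 2]
      ord[OF primes(2), of 2 2] ord[OF primes(3), of 1 4] ord[OF primes(4), of 1 3]
      ord[OF primes(5), of 1 2] ord[OF primes(1), of 3 3]
    by (auto simp: fact_numeral)
qed

text \<open>
  For an index \<open>m \<le> 4\<close> the order divides \<open>m!\<close> and hence 24, but every divisor of 24 from 4 on is an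
  excluded order.
\<close>

lemma index_ge_5:
  assumes H: "subgroup H G" and index: "m * card H = order G" and "m \<noteq> 1"
  shows "5 \<le> m"
proof (rule ccontr)
  assume "\<not> 5 \<le> m"
  moreover have "m \<noteq> 0" using index order_gt_one by (auto intro: gr0I)
  ultimately have "m \<in> {2, 3, 4}" using \<open>m \<noteq> 1\<close> by auto
  then have "fact m dvd (24::nat)" by (auto simp: fact_numeral)
  then have dvd: "order G dvd 24"
    using order_dvd_fact_index[OF fin H index \<open>m \<noteq> 1\<close>] dvd_trans by blast
  then have "order G \<le> 24" by (rule dvd_imp_le) simp
  then have "order G \<in> set [4..<25]" using order_ge_4 by (simp only: set_upt) simp
  then show False using dvd excluded_orders by (auto simp del: set_upt)
qed

text \<open>
  The order is the product of the size \<open>s \<ge> 6\<close> of a class and the order \<open>d \<ge> 2\<close> of a centralizer,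
  and all such products up to 25 are among the excluded orders.
\<close>

lemma order_gt_25:
  assumes "\<And>x. x \<in> carrier G \<Longrightarrow> x \<noteq> \<one> \<Longrightarrow> 6 * card (centralizer G x) \<le> order G"
  shows "25 < order G"
proof (rule ccontr)
  assume small: "\<not> 25 < order G"
  obtain x where x: "x \<in> carrier G" "x \<noteq> \<one>" by (rule exists_nontrivial)
  define s d where "s = card (conjugacy_class G x)" and "d = card (centralizer G x)"
  have sd: "s * d = order G" unfolding s_def d_def by (rule card_class_times_card_centralizer[OF x(1)])
  have d: "2 \<le> d" unfolding d_def by (rule centralizer_index(2)[OF x])
  have "6 * d \<le> s * d" using assms[OF x] by (simp add: d_def[symmetric] sd)
  then have s: "6 \<le> s" using d by simp
  have "d \<le> 4"
    using mult_le_mono[OF s order_refl, of d] sd small by linarith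
  then have "d \<in> {2, 3, 4}" using d by auto
  then consider "d = 2" | "d = 3" | "d = 4" by auto
  then show False
  proof cases
    case 1
    then have "s \<in> {6, 7, 8, 9, 10, 11, 12}" using s sd small by auto
    then show False using 1 sd excluded_orders by auto
  next
    case 2
    then have "s \<in> {6, 7, 8}" using s sd small by auto
    then show False using 2 sd excluded_orders by auto
  next
    case 3
    then have "s = 6" using s sd small by auto
    then show False using 3 sd excluded_orders by auto
  qed
qed

lemma card_conjugacy_class_ge_5:
  assumes x: "x \<in> carrier G" "x \<noteq> \<one>"
  shows "5 \<le> card (conjugacy_class G x)"
  by (rule index_ge_5[OF subgroup_centralizer[OF x(1)] card_class_times_card_centralizer[OF x(1)]
        centralizer_index(1)[OF x]])

section \<open>Complements of prime order\<close>

text \<open>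
  Since \<open>\<bar>P\<bar>\<close> is prime and does not divide \<open>\<bar>H\<bar>\<close>, the two subgroups meet trivially and \<open>G = P H\<close>, so
  \<open>P\<close> is transitive on the cosets of \<open>H\<close>.  An element of \<open>H\<close> that commutes
  with \<open>x\<close> commutes with \<open>P\<close>, which is generated by \<open>x\<close>; since it fixes the coset \<open>H\<close> it fixes all
  cosets and is trivial.  So \<open>C(x)\<close> meets \<open>H\<close> trivially, and there is room for \<open>\<bar>P\<bar>\<close> elements only.
\<close>

lemma centralizer_eq_prime_complement:
  assumes H: "subgroup H G" "card P * card H = order G" "\<not> card P dvd card H"
    and P: "subgroup P G" "Factorial_Ring.prime (card P)" and x: "x \<in> P" "x \<noteq> \<one>"
  shows "centralizer G x = P"
proof -
  interpret H: subgroup H G by (rule H(1))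
  interpret P: subgroup P G by (rule P(1))
  have xG: "x \<in> carrier G" using x by simp
  have "P \<inter> H = {\<one>}"
  proof (rule ccontr)
    assume "P \<inter> H \<noteq> {\<one>}"
    then obtain y where "y \<in> P" "y \<in> H" "y \<noteq> \<one>"
      using P.one_closed H.one_closed by auto
    then have "P \<subseteq> H" by (rule prime_subgroup_subset[OF P(1) P(2) H(1)])
    then show False using card_subgroup_dvd[OF P(1) H(1)] H(3) by simp
  qed
  then have "card (P <#> H) = order G"
    using card_set_mult_trivial_Int[OF P(1) H(1)] H(2) by simp
  then have PH: "P <#> H = carrier G"
    unfolding order_def by (rule card_subset_eq[OF fin setmult_subset_G[OF P.subset H.subset]])
  \<comment> \<open>\<open>C\<close> is the core of \<open>H\<close>, the kernel of the action on its cosets.\<close>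
  define C where "C = {g \<in> carrier G. \<forall>a\<in>carrier G. inv a \<otimes> g \<otimes> a \<in> H}"
  have C_sub: "C \<subseteq> H"
  proof
    fix g assume "g \<in> C"
    then have "g \<in> carrier G" "inv \<one> \<otimes> g \<otimes> \<one> \<in> H" unfolding C_def by blast+
    then show "g \<in> H" by simp
  qed
  have "C \<noteq> carrier G"
  proof
    assume "C = carrier G"
    then have "H = carrier G" using C_sub H.subset by (simp add: subset_antisym)
    then have "card P * order G = order G" using H(2) by (simp add: order_def)
    then show False using order_gt_one P(2) by simp
  qed
  then have C: "C = {\<one>}"
    using no_real_normal_subgroup[OF normal_core[OF H(1), folded C_def]] by blast
  have "centralizer G x \<inter> H \<subseteq> C"
  proof
    fix g assume g: "g \<in> centralizer G x \<inter> H"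
    then have gG: "g \<in> carrier G" by simp
    have "x \<in> centralizer G g" using g xG by (simp add: centralizer_def)
    then have P_commutes: "P \<subseteq> centralizer G g"
      using prime_subgroup_subset[OF P(1) P(2) subgroup_centralizer[OF gG]] x by blast
    have "inv a \<otimes> g \<otimes> a \<in> H" if "a \<in> carrier G" for a
    proof -
      obtain p h where a: "a = p \<otimes> h" "p \<in> P" "h \<in> H"
        using \<open>a \<in> carrier G\<close> PH unfolding set_mult_def by blast
      then have pG: "p \<in> carrier G" and hG: "h \<in> carrier G" by auto
      have "g \<otimes> p = p \<otimes> g" using P_commutes a(2) by (auto simp: centralizer_def)
      then have "inv p \<otimes> (g \<otimes> p) = g" using pG gG by (simp flip: m_assoc)
      moreover have "inv a \<otimes> g \<otimes> a = inv h \<otimes> (inv p \<otimes> (g \<otimes> p)) \<otimes> h"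
        using a(1) pG hG gG by (simp add: inv_mult_group m_assoc)
      ultimately have "inv a \<otimes> g \<otimes> a = inv h \<otimes> g \<otimes> h" by simp
      also have "\<dots> \<in> H" using g a(3) by simp
      finally show ?thesis .
    qed
    then show "g \<in> C" using gG by (simp add: C_def)
  qed
  moreover have sub_C: "subgroup (centralizer G x) G" by (rule subgroup_centralizer[OF xG])
  ultimately have "centralizer G x \<inter> H = {\<one>}"
    unfolding C using subgroup.one_closed[OF sub_C] by auto
  then have "card (centralizer G x) * card H \<le> order G"
    using card_set_mult_trivial_Int[OF sub_C H(1)]
      card_mono[OF fin setmult_subset_G[OF subgroup.subset[OF sub_C] H.subset]]
    by (simp add: order_def)
  moreover have "card H > 0" using H(2) order_gt_one by (auto intro: gr0I)
  ultimately have "card (centralizer G x) \<le> card P" unfolding H(2)[symmetric] by simp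
  moreover have "x \<in> centralizer G x" using xG by (simp add: centralizer_def)
  then have "P \<subseteq> centralizer G x"
    using prime_subgroup_subset[OF P(1) P(2) sub_C x(1)] x(2) by blast
  ultimately show ?thesis
    using card_seteq[OF finite_subset[OF subgroup.subset[OF sub_C] fin], of P] by simp
qed

text \<open>
  The index \<open>c\<close> of \<open>P\<close> is a multiple of the index of its normalizer, which is at least 5 because \<open>P\<close>
  is not normal.  A proper multiple would be at least 10.
\<close>

lemma normalizer_eq_prime_subgroup:
  assumes P: "subgroup P G" "Factorial_Ring.prime (card P)"
    and index: "card P * c = order G" "c \<noteq> 1" "c < 10"
  shows "normalizer G P = P"
proof -
  interpret P: subgroup P G by (rule P(1))
  let ?N = "normalizer G P"
  have N: "subgroup ?N G" by (rule normalizer_imp_subgroup[OF P.subset])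
  have "(\<lambda>h. g \<otimes> h \<otimes> inv g) ` P = P" if g: "g \<in> P" for g
  proof (rule card_seteq)
    show "finite P" using finite_subset[OF P.subset fin] .
  next
    show "(\<lambda>h. g \<otimes> h \<otimes> inv g) ` P \<subseteq> P" using g by auto
  next
    show "card P \<le> card ((\<lambda>h. g \<otimes> h \<otimes> inv g) ` P)"
      using g by (simp add: card_conj_image P.subset)
  qed
  then have P_le: "P \<subseteq> ?N" by (auto simp: mem_normalizer_iff P.subset)
  then obtain d where d: "card ?N = card P * d"
    using card_subgroup_dvd[OF P(1) N] by blast
  define m where "m = card (rcosets ?N)"
  have m: "m * card ?N = order G" unfolding m_def by (rule lagrange[OF N])
  have "m \<noteq> 1"
  proof
    assume "m = 1"
    then have "?N = carrier G"
      using m card_subset_eq[OF fin subgroup.subset[OF N]] by (simp add: order_def)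
    then have "P \<lhd> G"
      using P(1) by (auto simp: normal_inv_iff mem_normalizer_iff P.subset set_eq_iff)
    then have "P = carrier G \<or> P = {\<one>}" by (rule no_real_normal_subgroup)
    then show False using P(2) index(1,2) order_gt_one by (auto simp: order_def)
  qed
  then have "5 \<le> m" by (rule index_ge_5[OF N m])
  moreover have "card P * (m * d) = card P * c"
    using m index(1) unfolding d by (simp add: ac_simps)
  then have md: "m * d = c" using P(2) by auto
  ultimately have "5 * d < 10" using index(3) mult_le_mono1[of 5 m d] by linarith
  moreover have "d \<noteq> 0" using m d order_gt_one by (auto intro: gr0I)
  ultimately have "card ?N = card P" using d by simp
  then show ?thesis
    using card_subset_eq[OF finite_subset[OF subgroup.subset[OF N] fin] P_le] by simp
qed

text \<open>
  If \<open>P\<close> were its own normalizer, then distinct nontrivial elements of \<open>P\<close> would lie in distinct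
  classes, each of size \<open>\<bar>H\<bar>\<close> by \<open>centralizer_eq_prime_complement\<close>.  These classes avoid \<open>H\<close>, whose
  order is prime to \<open>\<bar>P\<bar>\<close>, and by their total size they exhaust \<open>G - H\<close>.  So \<open>H\<close> is closed under
  conjugation and contradicts simplicity.
\<close>

lemma normalizer_neq_prime_complement:
  assumes H: "subgroup H G" "card P * card H = order G" "\<not> card P dvd card H"
    and P: "subgroup P G" "Factorial_Ring.prime (card P)"
  shows "normalizer G P \<noteq> P"
proof
  assume N: "normalizer G P = P"
  interpret H: subgroup H G by (rule H(1))
  interpret P: subgroup P G by (rule P(1))
  have finP: "finite P" using finite_subset[OF P.subset fin] .
  have card_H: "card H \<noteq> 1"
  proof
    assume "card H = 1"
    then have "P = carrier G"
      using H(2) card_subset_eq[OF fin P.subset] by (simp add: order_def)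
    obtain x where x: "x \<in> carrier G" "x \<noteq> \<one>" by (rule exists_nontrivial)
    then have "centralizer G x = carrier G"
      using centralizer_eq_prime_complement[OF H P, of x] \<open>P = carrier G\<close> by simp
    then show False using centralizer_proper[OF x] by simp
  qed
  have class_sub: "conjugacy_class G p \<subseteq> carrier G" if "p \<in> carrier G" for p
    using that by (auto simp: conjugacy_class_def)
  have disjoint: "conjugacy_class G p \<inter> conjugacy_class G q = {}"
    if pq: "p \<in> P - {\<one>}" "q \<in> P - {\<one>}" "p \<noteq> q" for p q
  proof (rule ccontr)
    assume "conjugacy_class G p \<inter> conjugacy_class G q \<noteq> {}"
    then obtain g h where gh: "g \<in> carrier G" "h \<in> carrier G"
      "g \<otimes> p \<otimes> inv g = h \<otimes> q \<otimes> inv h"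
      by (auto simp: conjugacy_class_def)
    \<comment> \<open>An element that conjugates \<open>p\<close> to \<open>q\<close> normalizes \<open>P\<close>; hence it lies in \<open>P\<close> and centralizes \<open>p\<close>.\<close>
    define k where "k = inv h \<otimes> g"
    have G: "p \<in> carrier G" "q \<in> carrier G" "k \<in> carrier G"
      using pq gh by (auto simp: k_def)
    have "inv h \<otimes> (g \<otimes> p \<otimes> inv g) \<otimes> inv (inv h) = k \<otimes> p \<otimes> inv k"
      unfolding k_def using gh G by (intro conj_conj) auto
    moreover have "inv h \<otimes> (h \<otimes> q \<otimes> inv h) \<otimes> inv (inv h) = q"
      using gh G conj_conj[of "inv h" h q] by simp
    ultimately have kpk: "k \<otimes> p \<otimes> inv k = q" using gh(3) by simp
    let ?Q = "(\<lambda>x. k \<otimes> x \<otimes> inv k) ` P"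
    have "q \<in> ?Q" using kpk pq(1) by blast
    then have "P \<subseteq> ?Q"
      using prime_subgroup_subset[OF P(1) P(2) subgroup_conj_image[OF P(1) G(3)], of q] pq(2)
      by blast
    then have "?Q = P"
      using card_subset_eq[of ?Q P] card_conj_image[OF P.subset G(3)] finP by simp
    then have "k \<in> P" using N G(3) by (metis mem_normalizer_iff P.subset)
    then have "k \<in> centralizer G p" using centralizer_eq_prime_complement[OF H P, of p] pq(1) by simp
    then have "k \<otimes> p \<otimes> inv k = p"
      using commute_iff_conj_fixes[OF G(3,1)] by (simp add: centralizer_def)
    then show False using kpk pq(3) by simp
  qed
  \<comment> \<open>By disjointness \<open>E\<close> is as large as the complement of \<open>H\<close>; it will turn out to be this complement.\<close>
  define E where "E = (\<Union>p\<in>P - {\<one>}. conjugacy_class G p)"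
  have "card (conjugacy_class G p) = card H" if p: "p \<in> P - {\<one>}" for p
  proof -
    have "card (conjugacy_class G p) * card P = card H * card P"
      using card_class_times_card_centralizer[of p] centralizer_eq_prime_complement[OF H P, of p]
        p H(2) by (simp add: mult.commute)
    then show ?thesis using prime_gt_0_nat[OF P(2)] by simp
  qed
  then have "card E = (\<Sum>p\<in>P - {\<one>}. card H)"
    unfolding E_def using finP disjoint finite_subset[OF class_sub fin]
    by (subst card_UN_disjoint) auto
  also have "\<dots> = (card P - 1) * card H" using finP by simp
  finally have card_E: "card E = card P * card H - card H" by (simp add: diff_mult_distrib)
  have E_sub: "E \<subseteq> carrier G" unfolding E_def using class_sub P.subset by blast
  have "E \<inter> H = {}"
  proof (rule ccontr)
    assume "E \<inter> H \<noteq> {}"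
    then obtain p g where p: "p \<in> P" "p \<noteq> \<one>" and g: "g \<in> carrier G" "g \<otimes> p \<otimes> inv g \<in> H"
      by (auto simp: E_def conjugacy_class_def)
    let ?Q = "(\<lambda>x. g \<otimes> x \<otimes> inv g) ` P"
    have Q: "subgroup ?Q G" "card ?Q = card P"
      using subgroup_conj_image[OF P(1) g(1)] card_conj_image[OF P.subset g(1)] by simp_all
    have "g \<otimes> p \<otimes> inv g \<noteq> \<one>"
      using conjugation_is_inj[OF g(1), of p "\<one>"] p g(1) by auto
    moreover have "Factorial_Ring.prime (card ?Q)" unfolding Q(2) by (rule P(2))
    ultimately have "?Q \<subseteq> H"
      using prime_subgroup_subset[OF Q(1) _ H(1), of "g \<otimes> p \<otimes> inv g"] p(1) g(2) by blast
    then show False using card_subgroup_dvd[OF Q(1) H(1)] Q(2) H(3) by simp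
  qed
  then have "H \<subseteq> carrier G - E" using H.subset by blast
  moreover have "card (carrier G - E) = card H"
  proof -
    have "card H \<le> card P * card H" using prime_gt_0_nat[OF P(2)] by simp
    then show ?thesis
      using card_E H(2) E_sub fin by (simp add: card_Diff_subset finite_subset order_def)
  qed
  ultimately have H_eq: "H = carrier G - E"
    using fin by (intro card_subset_eq) auto
  have "g \<otimes> h \<otimes> inv g \<in> H" if g: "g \<in> carrier G" and h: "h \<in> H" for g h
  proof (rule ccontr)
    assume "g \<otimes> h \<otimes> inv g \<notin> H"
    then have "g \<otimes> h \<otimes> inv g \<in> E" using g h unfolding H_eq by auto
    then obtain p where p: "p \<in> P - {\<one>}" "g \<otimes> h \<otimes> inv g \<in> conjugacy_class G p"
      unfolding E_def by blast
    have "inv g \<otimes> (g \<otimes> h \<otimes> inv g) \<otimes> inv (inv g) \<in> conjugacy_class G p"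
      by (rule conjugacy_class_closed[OF inv_closed[OF g] _ p(2)]) (use p(1) in auto)
    moreover have "inv g \<otimes> (g \<otimes> h \<otimes> inv g) \<otimes> inv (inv g) = h"
      using g h conj_conj[of "inv g" g h] by simp
    ultimately have "h \<in> E" using p(1) unfolding E_def by auto
    then show False using h unfolding H_eq by blast
  qed
  then have "H \<lhd> G" using H(1) by (simp add: normal_inv_iff)
  then have "H = carrier G \<or> H = {\<one>}" by (rule no_real_normal_subgroup)
  moreover have "H \<noteq> {\<one>}" using card_H by auto
  moreover have "H \<noteq> carrier G"
  proof
    assume "H = carrier G"
    then have "card P * order G = order G" using H(2) by (simp add: order_def)
    then show False using order_gt_one P(2) by simp
  qed
  ultimately show False by blast
qed

section \<open>Counting commuting pairs\<close>

text \<open>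
  With \<open>n = 5 c\<close>, the identity contributes \<open>5 c\<close>, the class of an element of order 5 contributes
  \<open>5 c\<close>, and the remaining \<open>4 c - 1\<close> elements contribute at most \<open>c\<close> each.  The total
  \<open>4 c^2 + 9 c\<close> is less than \<open>n^2 / 5 = 5 c^2\<close> precisely when \<open>c > 9\<close>.
\<close>

lemma commuting_pairs_bound_index_5:
  assumes H: "subgroup H G" "5 * card H = order G"
  shows "5 * card (commuting_pairs G) < (order G)\<^sup>2"
proof -
  define c where "c = card H"
  have n: "order G = 5 * c" using H(2) by (simp add: c_def)
  have "order G dvd fact 5" by (rule order_dvd_fact_index[OF fin H]) simp
  then have "5 * c dvd 5 * 24" unfolding n by (simp add: fact_numeral)
  then have c_dvd: "c dvd 24" by simp
  have H5: "\<not> 5 dvd card H"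
  proof
    assume "5 dvd card H"
    then have "(5::nat) dvd 24" using c_dvd c_def dvd_trans by blast
    then show False by simp
  qed
  obtain P where P: "subgroup P G" "card P = 5"
    using sylow_thm[of 5 G 1 c] is_group fin n by auto
  interpret P: subgroup P G by (rule P(1))
  have centralizer: "centralizer G y = K"
    if "subgroup K G" "card K = 5" "y \<in> K" "y \<noteq> \<one>" for K y
    using centralizer_eq_prime_complement[of H K y] H H5 that by simp
  have "P \<noteq> {\<one>}" using P(2) by auto
  then obtain x where x: "x \<in> P" "x \<noteq> \<one>" using P.one_closed by auto
  have "c \<noteq> 1"
    using centralizer[OF P x] centralizer_proper[of x] x n P(2) card_subset_eq[OF fin P.subset]
    by (auto simp: order_def)
  have c: "10 \<le> c"
  proof (rule ccontr)
    assume "\<not> 10 \<le> c"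
    then have "normalizer G P = P"
      using normalizer_eq_prime_subgroup[of P c] P n \<open>c \<noteq> 1\<close> by simp
    moreover have "normalizer G P \<noteq> P"
      using normalizer_neq_prime_complement[of H P] H H5 P by simp
    ultimately show False by blast
  qed
  define E where "E = conjugacy_class G x"
  have E_sub: "E \<subseteq> carrier G - {\<one>}"
  proof
    fix y assume "y \<in> E"
    then obtain g where g: "g \<in> carrier G" "y = g \<otimes> x \<otimes> inv g"
      by (auto simp: E_def conjugacy_class_def)
    then show "y \<in> carrier G - {\<one>}"
      using conjugation_is_inj[OF g(1), of x "\<one>"] x by auto
  qed
  have "card (centralizer G x) = 5" using centralizer[OF P x] P(2) by simp
  then have card_E: "card E = c"
    using card_class_times_card_centralizer[of x] x n by (simp add: E_def)
  have E_cent: "card (centralizer G y) = 5" if y: "y \<in> E" for y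
  proof -
    obtain g where g: "g \<in> carrier G" "y = g \<otimes> x \<otimes> inv g"
      using y by (auto simp: E_def conjugacy_class_def)
    let ?Q = "(\<lambda>x. g \<otimes> x \<otimes> inv g) ` P"
    have Q: "subgroup ?Q G" "card ?Q = 5"
      using subgroup_conj_image[OF P(1) g(1)] card_conj_image[OF P.subset g(1)] P(2) by simp_all
    have "y \<in> ?Q" using g(2) x(1) by blast
    then have "centralizer G y = ?Q"
      using centralizer[OF Q] y E_sub by blast
    then show ?thesis using Q(2) by simp
  qed
  have finE: "finite E" using E_sub fin by (meson finite_Diff finite_subset)
  let ?R = "carrier G - {\<one>} - E"
  have "card ?R = 5 * c - 1 - c"
    using E_sub fin finE card_E n by (simp add: card_Diff_subset order_def)
  moreover have "card (centralizer G y) \<le> c" if "y \<in> ?R" for y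
  proof -
    have y: "y \<in> carrier G" "y \<noteq> \<one>" using that by auto
    have "5 * card (centralizer G y) \<le> order G"
      using mult_le_mono1[OF card_conjugacy_class_ge_5[OF y]]
      unfolding card_class_times_card_centralizer[OF y(1), symmetric] .
    then show ?thesis using n by simp
  qed
  ultimately have rest: "(\<Sum>y\<in>?R. card (centralizer G y)) \<le> (5 * c - 1 - c) * c"
    using sum_bounded_above[of ?R "\<lambda>y. card (centralizer G y)" c] by simp
  have "carrier G = insert \<one> (E \<union> ?R)" using E_sub by auto
  then have "card (commuting_pairs G) = (\<Sum>y\<in>insert \<one> (E \<union> ?R). card (centralizer G y))"
    using card_commuting_pairs[OF fin] by simp
  also have "\<dots> = card (centralizer G \<one>) + (\<Sum>y\<in>E \<union> ?R. card (centralizer G y))"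
    using E_sub fin finE by (subst sum.insert) auto
  also have "(\<Sum>y\<in>E \<union> ?R. card (centralizer G y))
      = (\<Sum>y\<in>E. card (centralizer G y)) + (\<Sum>y\<in>?R. card (centralizer G y))"
    using fin finE by (intro sum.union_disjoint) auto
  also have "(\<Sum>y\<in>E. card (centralizer G y)) = 5 * c" using E_cent card_E by simp
  also have "centralizer G \<one> = carrier G" by (auto simp: centralizer_def)
  finally have "card (commuting_pairs G) \<le> 5 * c + (5 * c + (5 * c - 1 - c) * c)"
    using rest n by (simp add: order_def)
  also have "\<dots> = 9 * c + 4 * (c * c)"
    by (cases c) (auto simp: algebra_simps)
  finally have "5 * card (commuting_pairs G) \<le> 45 * c + 20 * (c * c)" by simp
  also have "\<dots> < 25 * (c * c)"
    using mult_le_mono1[OF c, of c] c by simp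
  finally show ?thesis by (simp add: n power2_eq_square)
qed

text \<open>
  The identity contributes \<open>n\<close> and every other element at most \<open>n / 6\<close>.  The total \<open>(n^2 + 5 n) / 6\<close>
  is less than \<open>n^2 / 5\<close> precisely when \<open>n > 25\<close>.
\<close>

lemma commuting_pairs_bound_index_ge_6:
  assumes small: "\<And>x. x \<in> carrier G \<Longrightarrow> x \<noteq> \<one> \<Longrightarrow> 6 * card (centralizer G x) \<le> order G"
  shows "5 * card (commuting_pairs G) < (order G)\<^sup>2"
proof -
  define n where "n = order G"
  have n: "25 < n" unfolding n_def by (rule order_gt_25[OF small])
  have "6 * card (commuting_pairs G) = (\<Sum>x\<in>carrier G. 6 * card (centralizer G x))"
    using card_commuting_pairs[OF fin] by (simp add: sum_distrib_left)
  also have "\<dots> = 6 * card (centralizer G \<one>) + (\<Sum>x\<in>carrier G - {\<one>}. 6 * card (centralizer G x))"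
    using fin by (subst sum.remove[of _ \<one>]) auto
  also have "centralizer G \<one> = carrier G" by (auto simp: centralizer_def)
  also have "(\<Sum>x\<in>carrier G - {\<one>}. 6 * card (centralizer G x)) \<le> (\<Sum>x\<in>carrier G - {\<one>}. n)"
    using small by (intro sum_mono) (auto simp: n_def)
  also have "\<dots> = (n - 1) * n" using fin by (simp add: n_def order_def)
  finally have "6 * card (commuting_pairs G) \<le> 6 * n + (n - 1) * n" by (simp add: n_def order_def)
  also have "\<dots> = 5 * n + n * n" using n by (cases n) auto
  finally have "30 * card (commuting_pairs G) \<le> 25 * n + 5 * (n * n)" by simp
  also have "\<dots> < 6 * (n * n)" using n by simp
  finally show ?thesis by (simp add: n_def power2_eq_square)
qed

lemma commuting_pairs_bound: "5 * card (commuting_pairs G) < (order G)\<^sup>2"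
proof (cases "\<exists>x\<in>carrier G - {\<one>}. card (conjugacy_class G x) = 5")
  case True
  then obtain x where x: "x \<in> carrier G" "card (conjugacy_class G x) = 5" by blast
  with card_class_times_card_centralizer[OF x(1)] show ?thesis
    by (intro commuting_pairs_bound_index_5[OF subgroup_centralizer[OF x(1)]]) simp
next
  case False
  have "6 * card (centralizer G x) \<le> order G" if x: "x \<in> carrier G" "x \<noteq> \<one>" for x
  proof -
    note eq = card_class_times_card_centralizer[OF x(1)]
    have "5 \<le> card (conjugacy_class G x)" by (rule card_conjugacy_class_ge_5[OF x])
    moreover have "card (conjugacy_class G x) \<noteq> 5" using False x by blast
    ultimately have "6 \<le> card (conjugacy_class G x)" by linarith
    then show ?thesis unfolding eq[symmetric] by simp
  qed
  then show ?thesis by (rule commuting_pairs_bound_index_ge_6)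
qed

end

theorem proposition21:
  fixes G (structure)
  assumes "simple_group G"
    and "finite (carrier G)"
    and "\<not> comm_group G"
  shows "cp G < 1 / 5"
proof -
  interpret finite_nonabelian_simple_group G
    by (intro finite_nonabelian_simple_group.intro finite_nonabelian_simple_group_axioms.intro assms)
  have "real (5 * card (commuting_pairs G)) < real ((order G)\<^sup>2)"
    using commuting_pairs_bound by (rule of_nat_less_iff[THEN iffD2])
  moreover have "0 < real (order G)" using order_gt_one by simp
  ultimately show ?thesis by (simp add: cp_def divide_simps)
qed

end
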